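(* Let $m\ge 1$ be an integer, and for integers $k$ put $C(k):=k(k-1)(k-3/2)^2$. Let $u:\mathbb{Z}\to\mathbb{C}$ be finitely supported with $u(0)=0$. Then for every integer $k\ge 2m$, $$\sum_{n\in\mathbb{Z}}|\Delta^m u(n)|^2 n^{2k}\;\ge\;\prod_{i=0}^{m-1}C(k-2i)\sum_{n\in\mathbb{Z}}|u(n)|^2 n^{2k-4m},$$ and for every integer $k\ge 2m+1$, $$\sum_{n\in\mathbb{Z}}|D(\Delta^m u)(n)|^2\Big(n-\frac12\Big)^{2k}\;\ge\;\frac{(2k-1)^2}{4}\prod_{i=0}^{m-1}C(k-1-2i)\sum_{n\in\mathbb{Z}}|u(n)|^2 n^{2k-4m-2}.$$
   Context: For $u:\mathbb{Z}\to\mathbb{C}$: $Du(n):=u(n)-u(n-1)$ and $\Delta u(n):=2u(n)-u(n-1)-u(n+1)$; $\Delta^m$ is the $m$-fold iterate. The convention $n^0=1$ is used (irrelevant at $n=0$ since $u(0)=0$). *)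

theory Defs
  imports "HOL-Analysis.Analysis"
begin

definition bdiff :: "(int \<Rightarrow> complex) \<Rightarrow> int \<Rightarrow> complex" where
  "bdiff u n = u n - u (n - 1)"

definition lap :: "(int \<Rightarrow> complex) \<Rightarrow> int \<Rightarrow> complex" where
  "lap u n = 2 * u n - u (n - 1) - u (n + 1)"

definition rellich_const :: "int \<Rightarrow> real" where
  "rellich_const k = of_int k * (of_int k - 1) * (of_int k - 3/2)\<^sup>2"

end

theory Submission
  imports Defs
begin

text \<open>
  The weights are polynomials, and with \<open>y = x + 1/2\<close>, \<open>y' = x - 1/2\<close> one has \<open>x\<^sup>2 = y y' + 1/4\<close>.
  Expanding \<open>x\<^sup>2\<^sup>k = (y y' + 1/4)\<^sup>k\<close> in the cross term of \<open>x\<^sup>2\<^sup>k \<bar>Du\<bar>\<^sup>2\<close> writes the weighted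
  energy as a positive combination of the unweighted energies of \<open>n\<^sup>j u\<close>, \<open>j \<le> k\<close>, plus a
  potential term bounded below by \<open>k (k - 1) y\<^sup>2\<^sup>k\<^sup>-\<^sup>2\<close>. On the integers the energy of \<open>n\<^sup>k u\<close> gives
  a further \<open>1/4\<close> by the classical Hardy inequality, so the constant is \<open>(k - 1/2)\<^sup>2\<close>. On the
  half-integers, where \<open>Du\<close> lives, only \<open>k (k - 1)\<close> is used. As \<open>\<Delta>u\<close> is up to sign a
  difference of \<open>Du\<close>, the two steps compose to the Rellich inequality, which is then iterated.
\<close>

section \<open>Finite support and summation by parts on the integers\<close>

lemma summable_on_finite_support:
  fixes f :: "'a \<Rightarrow> real"
  assumes "finite {n. u n \<noteq> 0}" and "\<And>n. u n = 0 \<Longrightarrow> f n = 0"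
  shows "f summable_on UNIV"
  using assms by (intro finite_nonzero_values_imp_summable_on) (auto elim!: rev_finite_subset)

lemma infsum_shift_int:
  fixes f :: "int \<Rightarrow> real"
  shows "(\<Sum>\<^sub>\<infinity>n. f (n + c)) = (\<Sum>\<^sub>\<infinity>n. f n)"
  by (rule infsum_reindex_bij_betw) (rule bij_plus_right)

lemma finite_support_shift:
  fixes u :: "int \<Rightarrow> 'a::zero"
  assumes "finite {n. u n \<noteq> 0}"
  shows "finite {n. u (n + c) \<noteq> 0}"
proof -
  have "{n. u (n + c) \<noteq> 0} \<subseteq> (\<lambda>n. n - c) ` {n. u n \<noteq> 0}"
    by (force simp: image_iff)
  then show ?thesis using assms by (meson finite_imageI finite_subset)
qed

lemma finite_support_bdiff:
  assumes "finite {n. u n \<noteq> 0}"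
  shows "finite {n. bdiff u n \<noteq> 0}"
  by (rule finite_subset[of _ "{n. u n \<noteq> 0} \<union> {n. u (n + - 1) \<noteq> 0}"])
     (use assms finite_support_shift[OF assms, of "-1"] in \<open>auto simp: bdiff_def\<close>)

lemma lap_eq_bdiff_bdiff: "lap u n = - bdiff (bdiff u) (n + 1)"
  by (simp add: lap_def bdiff_def)

lemma finite_support_lap:
  assumes "finite {n. u n \<noteq> 0}"
  shows "finite {n. lap u n \<noteq> 0}"
  using finite_support_shift[OF finite_support_bdiff[OF finite_support_bdiff[OF assms]], of 1]
  by (simp add: lap_eq_bdiff_bdiff)

lemma finite_support_lap_funpow:
  assumes "finite {n. u n \<noteq> 0}"
  shows "finite {n. (lap ^^ m) u n \<noteq> 0}"
  by (induction m) (simp_all add: assms finite_support_lap)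

lemma cmod_diff_squared: "(cmod (a - b))\<^sup>2 = (cmod a)\<^sup>2 + (cmod b)\<^sup>2 - 2 * Re (a * cnj b)"
  by (simp only: cmod_power2) (simp add: power2_eq_square algebra_simps)

text \<open>The energy \<open>E n\<close> lives on the edge from \<open>n - 1\<close> to
  \<open>n\<close>, and \<open>A n\<close>, \<open>B n\<close> are the shares charged to its two
  endpoints. Shifting the \<open>B\<close> sum by one collects at \<open>n\<close> the share
  \<open>A n\<close> of the left edge and \<open>B (n + 1)\<close> of the right edge, so edgewise
  estimates become a bound with potential \<open>V\<close>.\<close>

lemma infsum_telescope_weights:
  fixes A B :: "int \<Rightarrow> real"
  assumes "finite {n. u n \<noteq> 0}"
    and le: "\<And>n. A n * (cmod (u n))\<^sup>2 + B n * (cmod (u (n - 1)))\<^sup>2 \<le> E n"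
    and E: "E summable_on UNIV"
    and V: "\<And>n. V n * (cmod (u n))\<^sup>2 \<le> (A n + B (n + 1)) * (cmod (u n))\<^sup>2"
  shows "(\<Sum>\<^sub>\<infinity>n. V n * (cmod (u n))\<^sup>2) \<le> (\<Sum>\<^sub>\<infinity>n. E n)"
proof -
  define b where "b n = B n * (cmod (u (n - 1)))\<^sup>2" for n
  have sum_b: "b summable_on UNIV"
    unfolding b_def using finite_support_shift[OF assms(1), of "-1"]
    by (intro summable_on_finite_support[where u = "\<lambda>n. u (n - 1)"]) auto
  have sum_A: "(\<lambda>n. A n * (cmod (u n))\<^sup>2) summable_on UNIV"
    by (intro summable_on_finite_support[OF assms(1)]) auto
  have sum_b1: "(\<lambda>n. b (n + 1)) summable_on UNIV"
    unfolding b_def by (intro summable_on_finite_support[OF assms(1)]) auto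
  have "(\<Sum>\<^sub>\<infinity>n. V n * (cmod (u n))\<^sup>2) \<le> (\<Sum>\<^sub>\<infinity>n. A n * (cmod (u n))\<^sup>2 + b (n + 1))"
    using V by (intro infsum_mono summable_on_add sum_A sum_b1 summable_on_finite_support[OF assms(1)])
      (auto simp: b_def algebra_simps)
  also have "\<dots> = (\<Sum>\<^sub>\<infinity>n. A n * (cmod (u n))\<^sup>2) + (\<Sum>\<^sub>\<infinity>n. b n)"
    by (simp add: infsum_add sum_A sum_b1 infsum_shift_int)
  also have "\<dots> = (\<Sum>\<^sub>\<infinity>n. A n * (cmod (u n))\<^sup>2 + b n)"
    by (simp add: infsum_add sum_A sum_b)
  also have "\<dots> \<le> (\<Sum>\<^sub>\<infinity>n. E n)"
    by (intro infsum_mono summable_on_add sum_A sum_b E) (use le in \<open>auto simp: b_def\<close>)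
  finally show ?thesis .
qed

subsection \<open>The classical Hardy inequality on the integers\<close>

text \<open>Squaring the sum leaves the single root \<open>sqrt (1 - x^2)\<close>, which is at most
  \<open>1 - x^2 / 2\<close>; adding \<open>(x^2 / 4)^2\<close> then completes the square.\<close>

lemma sqrt_sum_le:
  fixes x :: real
  assumes "\<bar>x\<bar> \<le> 1"
  shows "sqrt (1 + x) + sqrt (1 - x) \<le> 2 - x\<^sup>2 / 4"
proof -
  have sq: "(sqrt (1 + x) + sqrt (1 - x))\<^sup>2 = 2 + 2 * sqrt (1 - x\<^sup>2)"
  proof -
    have "sqrt (1 + x) * sqrt (1 - x) = sqrt (1 - x\<^sup>2)"
      by (simp add: power2_eq_square algebra_simps flip: real_sqrt_mult)
    then show ?thesis using assms by (simp add: power2_sum abs_le_iff)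
  qed
  have x2: "x\<^sup>2 \<le> 1" using assms by (simp add: abs_square_le_1)
  have "(1 - x\<^sup>2 / 2)\<^sup>2 = 1 - x\<^sup>2 + (x\<^sup>2 / 2)\<^sup>2" by (simp only: power2_diff) simp
  then have "1 - x\<^sup>2 \<le> (1 - x\<^sup>2 / 2)\<^sup>2" by simp
  then have "sqrt (1 - x\<^sup>2) \<le> 1 - x\<^sup>2 / 2"
    using x2 by (intro real_le_lsqrt) auto
  then have "(sqrt (1 + x) + sqrt (1 - x))\<^sup>2 \<le> 4 - x\<^sup>2" using sq by simp
  also have "\<dots> \<le> 4 - x\<^sup>2 + (x\<^sup>2 / 4)\<^sup>2" by simp
  also have "\<dots> = (2 - x\<^sup>2 / 4)\<^sup>2" by (simp only: power2_diff) simp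
  finally show ?thesis by (rule power2_le_imp_le) (use x2 in simp)
qed

text \<open>The right side is \<Delta>w / w for the trial function \<open>w n = sqrt |n|\<close>;
  the bound is the previous one at \<open>x = 1 / n\<close>.\<close>

lemma sqrt_sum_int_le:
  fixes n :: int
  assumes "n \<noteq> 0"
  shows "1 / (4 * (real_of_int n)\<^sup>2)
    \<le> (1 - sqrt \<bar>real_of_int (n - 1) / n\<bar>) + (1 - sqrt \<bar>real_of_int (n + 1) / n\<bar>)"
proof -
  define x where "x = 1 / real_of_int n"
  have x: "\<bar>x\<bar> \<le> 1" using assms by (auto simp: x_def divide_simps)
  have "real_of_int (n - 1) / n = 1 - x" "real_of_int (n + 1) / n = 1 + x"
    using assms by (auto simp: x_def divide_simps)
  moreover have "\<bar>1 - x\<bar> = 1 - x" "\<bar>1 + x\<bar> = 1 + x" using x by auto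
  moreover have "1 / (4 * (real_of_int n)\<^sup>2) = x\<^sup>2 / 4" by (simp add: x_def power_divide)
  ultimately show ?thesis using sqrt_sum_le[OF x] by simp
qed

text \<open>Weighted AM-GM for the cross term; the free ratio \<open>r\<close> is to be taken from
  the trial function.\<close>

lemma cmod_diff_squared_ge:
  fixes r :: real
  assumes "r > 0"
  shows "(1 - r) * (cmod a)\<^sup>2 + (1 - 1 / r) * (cmod b)\<^sup>2 \<le> (cmod (a - b))\<^sup>2"
proof -
  have "2 * Re (a * cnj b) \<le> 2 * (cmod a * cmod b)"
    using complex_Re_le_cmod[of "a * cnj b"] by (simp add: norm_mult)
  also have "\<dots> \<le> r * (cmod a)\<^sup>2 + (cmod b)\<^sup>2 / r"
  proof -
    have "0 \<le> (r * cmod a - cmod b)\<^sup>2 / r" using assms by simp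
    also have "\<dots> = r * (cmod a)\<^sup>2 + (cmod b)\<^sup>2 / r - 2 * (cmod a * cmod b)"
      using assms by (simp add: field_simps power2_eq_square)
    finally show ?thesis by simp
  qed
  finally show ?thesis by (simp add: cmod_diff_squared algebra_simps)
qed

text \<open>Ground state argument with \<open>w n = sqrt |n|\<close>: on each edge away from 0 the
  cross term is split with \<open>r = w (n - 1) / w n\<close>, and the shares meeting at
  \<open>n\<close> add up to \<Delta>w / w.\<close>

lemma hardy_int:
  assumes fin: "finite {n. v n \<noteq> 0}" and v0: "v 0 = 0"
  shows "(\<Sum>\<^sub>\<infinity>n. 1 / (4 * (real_of_int n)\<^sup>2) * (cmod (v n))\<^sup>2) \<le> (\<Sum>\<^sub>\<infinity>n. (cmod (bdiff v n))\<^sup>2)"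
proof (rule infsum_telescope_weights[OF fin, where
    A = "\<lambda>n. 1 - sqrt \<bar>real_of_int (n - 1) / n\<bar>" and
    B = "\<lambda>n. 1 - sqrt \<bar>real_of_int n / (n - 1)\<bar>"])
  show "(\<lambda>n. (cmod (bdiff v n))\<^sup>2) summable_on UNIV"
    by (rule summable_on_finite_support[OF finite_support_bdiff[OF fin]]) simp
  fix n :: int
  show "1 / (4 * (real_of_int n)\<^sup>2) * (cmod (v n))\<^sup>2
    \<le> (1 - sqrt \<bar>real_of_int (n - 1) / n\<bar> + (1 - sqrt \<bar>real_of_int (n + 1) / (n + 1 - 1)\<bar>)) * (cmod (v n))\<^sup>2"
  proof (cases "n = 0")
    case False
    show ?thesis
      using mult_right_mono[OF sqrt_sum_int_le[OF False], of "(cmod (v n))\<^sup>2"] by simp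
  qed (simp add: v0)
  show "(1 - sqrt \<bar>real_of_int (n - 1) / n\<bar>) * (cmod (v n))\<^sup>2
    + (1 - sqrt \<bar>real_of_int n / (n - 1)\<bar>) * (cmod (v (n - 1)))\<^sup>2 \<le> (cmod (bdiff v n))\<^sup>2"
  \<comment> \<open>These are the two edges touching 0, where the ratio degenerates. Since
    \<open>v 0 = 0\<close>, the energy there equals the one surviving term, whose coefficient
    evaluates to 1.\<close>
  proof (cases "n = 0 \<or> n = 1")
    case True
    then show ?thesis using v0 by (auto simp: bdiff_def)
  next
    case False
    then show ?thesis
      using cmod_diff_squared_ge[of "sqrt \<bar>real_of_int (n - 1) / n\<bar>" "v n" "v (n - 1)"]
      by (simp add: bdiff_def real_sqrt_divide)
  qed
qed

subsection \<open>Polynomial weights\<close>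

text \<open>All three sides keep the lowest terms of a binomial expansion that is even in
  \<open>y\<close> with nonnegative coefficients. They are proved together because the even sum
  \<open>S\<close> and \<open>y\<close> times the odd difference, \<open>d\<close>, satisfy a closed
  recursion.\<close>

lemma power_sum_diff_ge:
  fixes t y :: real
  assumes "t \<ge> 0"
  shows "(t + y) ^ Suc i + (t - y) ^ Suc i \<ge> 2 * t ^ Suc i"
    and "y * ((t + y) ^ Suc i - (t - y) ^ Suc i) \<ge> 2 * (real i + 1) * t ^ i * y\<^sup>2"
    and "(t + y) ^ (i + 2) + (t - y) ^ (i + 2)
      \<ge> 2 * t ^ (i + 2) + (real i + 2) * (real i + 1) * t ^ i * y\<^sup>2"
proof (induction i)
  case 0
  {
    case 1 show ?case by simp
  next
    case 2 show ?case by (simp add: power2_eq_square algebra_simps)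
  next
    case 3 show ?case by (simp add: power2_eq_square algebra_simps)
  }
next
  case (Suc i)
  define S where "S i = (t + y) ^ i + (t - y) ^ i" for i
  define d where "d i = y * ((t + y) ^ i - (t - y) ^ i)" for i
  have S_Suc: "S (Suc i) = t * S i + d i" for i
    by (simp add: S_def d_def algebra_simps)
  have d_Suc: "d (Suc i) = t * d i + y\<^sup>2 * S i" for i
    by (simp add: S_def d_def algebra_simps power2_eq_square)
  have 1: "S (Suc i) \<ge> 2 * t ^ Suc i" and 2: "d (Suc i) \<ge> 2 * (real i + 1) * t ^ i * y\<^sup>2"
    and 3: "S (Suc (Suc i)) \<ge> 2 * t ^ Suc (Suc i) + (real i + 2) * (real i + 1) * t ^ i * y\<^sup>2"
    using Suc by (simp_all add: S_def d_def)
  have "0 \<le> (real i + 2) * (real i + 1) * t ^ i * y\<^sup>2" using assms by simp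
  with 3 have S2: "S (Suc (Suc i)) \<ge> 2 * t ^ Suc (Suc i)" by linarith
  have "t * d (Suc i) \<ge> t * (2 * (real i + 1) * t ^ i * y\<^sup>2)"
    using 2 assms by (rule mult_left_mono)
  moreover have "y\<^sup>2 * S (Suc i) \<ge> y\<^sup>2 * (2 * t ^ Suc i)"
    using 1 by (rule mult_left_mono) simp
  ultimately have d2: "d (Suc (Suc i)) \<ge> 2 * (real (Suc i) + 1) * t ^ Suc i * y\<^sup>2"
    unfolding d_Suc[of "Suc i"] by (simp add: algebra_simps)
  have "t * S (Suc (Suc i)) \<ge> t * (2 * t ^ Suc (Suc i) + (real i + 2) * (real i + 1) * t ^ i * y\<^sup>2)"
    using 3 assms by (rule mult_left_mono)
  with d2 have S3: "S (Suc (Suc (Suc i)))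
      \<ge> 2 * t ^ Suc (Suc (Suc i)) + (real (Suc i) + 2) * (real (Suc i) + 1) * t ^ Suc i * y\<^sup>2"
    unfolding S_Suc[of "Suc (Suc i)"] by (simp add: algebra_simps)
  {
    case 1 show ?case using S2 by (simp add: S_def)
  next
    case 2 show ?case using d2 by (simp add: d_def)
  next
    case 3 show ?case using S3 by (simp add: S_def)
  }
qed

text \<open>With \<open>t = y^2 + 1/4\<close> one has \<open>(y - 1/2)^2 = t - y\<close> and
  \<open>(y + 1/2)^2 = t + y\<close>, so the right side is a second difference of a power at
  \<open>t\<close>. Its quadratic term suffices, as \<open>t\<close> is at least
  \<open>y^2\<close>.\<close>

lemma potential_ge:
  fixes y :: real
  shows "(real j + 1) * real j * y ^ (2 * j)
    \<le> (y - 1/2) ^ (2 * Suc j) + (y + 1/2) ^ (2 * Suc j) - 2 * (y\<^sup>2 + 1/4) ^ Suc j"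
proof -
  define t where "t = y\<^sup>2 + 1/4"
  have t: "t \<ge> 0" "(y - 1/2)\<^sup>2 = t - y" "(y + 1/2)\<^sup>2 = t + y" "t \<ge> y\<^sup>2"
    by (auto simp: t_def power2_eq_square algebra_simps)
  show ?thesis
  proof (cases j)
    case 0
    then show ?thesis by (simp add: power2_eq_square algebra_simps)
  next
    case (Suc i)
    have "y ^ (2 * j) = (y\<^sup>2) ^ i * y\<^sup>2" by (simp only: Suc power_mult power_Suc2)
    also have "\<dots> \<le> t ^ i * y\<^sup>2" using t by (intro mult_right_mono power_mono) auto
    finally have "(real i + 2) * (real i + 1) * y ^ (2 * j) \<le> (real i + 2) * (real i + 1) * (t ^ i * y\<^sup>2)"
      by (intro mult_left_mono) auto
    also have "\<dots> \<le> (t + y) ^ (i + 2) + (t - y) ^ (i + 2) - 2 * t ^ (i + 2)"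
      using power_sum_diff_ge(3)[OF t(1), of i y] by simp
    finally show ?thesis unfolding power_mult t(2,3) t_def[symmetric] by (simp add: Suc add_ac)
  qed
qed

text \<open>The midpoint \<open>x\<close> satisfies \<open>x^2 = y * y' + 1/4\<close>. The binomial
  expansion of \<open>x ^ (2 * k)\<close> turns the cross term into those of the squares
  \<open>e j\<close>, while the same coefficients \<open>c j\<close> sum the diagonal terms to
  powers of \<open>y^2 + 1/4\<close> and \<open>y'^2 + 1/4\<close>.\<close>

lemma weighted_difference_ge:
  fixes y y' :: real and a b :: complex
  assumes y': "y' = y - 1"
  defines "x \<equiv> y - 1/2"
  shows "(cmod (y ^ k * a - y' ^ k * b))\<^sup>2
      + (x ^ (2 * k) - (y\<^sup>2 + 1/4) ^ k) * (cmod a)\<^sup>2 + (x ^ (2 * k) - (y'\<^sup>2 + 1/4) ^ k) * (cmod b)\<^sup>2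
    \<le> (cmod (a - b))\<^sup>2 * x ^ (2 * k)"
proof -
  define \<rho> where "\<rho> = Re (a * cnj b)"
  define c where "c j = real (k choose j) * (1/4) ^ (k - j)" for j
  define e where "e j = (cmod (y ^ j * a - y' ^ j * b))\<^sup>2" for j
  have e: "e j = (y\<^sup>2) ^ j * (cmod a)\<^sup>2 + (y'\<^sup>2) ^ j * (cmod b)\<^sup>2 - 2 * (y * y') ^ j * \<rho>" for j
  proof -
    have "Re (of_real y ^ j * a * cnj (of_real y' ^ j * b)) = (y * y') ^ j * \<rho>"
      by (simp add: \<rho>_def power_mult_distrib algebra_simps flip: of_real_power)
    then show ?thesis
      by (simp add: e_def cmod_diff_squared norm_mult norm_power power_mult_distrib power_even_abs
          flip: power_mult) (simp add: mult.commute)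
  qed
  have binom: "(z + 1/4) ^ k = (\<Sum>j\<le>k. c j * z ^ j)" for z :: real
    by (simp add: binomial_ring c_def algebra_simps)
  have "x\<^sup>2 = y * y' + 1/4" by (simp add: x_def y' power2_eq_square algebra_simps)
  then have x: "x ^ (2 * k) = (\<Sum>j\<le>k. c j * (y * y') ^ j)" by (simp add: power_mult binom)
  \<comment> \<open>Only the top square is kept, with \<open>c k = 1\<close>; the others are
    nonnegative.\<close>
  have "e k \<le> (\<Sum>j\<le>k. c j * e j)"
    using member_le_sum[of k "{..k}" "\<lambda>j. c j * e j"] by (simp add: c_def e_def)
  also have "\<dots> = (y\<^sup>2 + 1/4) ^ k * (cmod a)\<^sup>2 + (y'\<^sup>2 + 1/4) ^ k * (cmod b)\<^sup>2 - 2 * x ^ (2 * k) * \<rho>"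
    unfolding binom x e sum_distrib_right sum_distrib_left sum.distrib[symmetric] sum_subtractf[symmetric]
    by (rule sum.cong) (simp_all add: algebra_simps)
  finally show ?thesis
    by (simp add: e_def cmod_diff_squared[of a b] \<rho>_def algebra_simps)
qed

section \<open>Weighted energy and Hardy inequalities\<close>

text \<open>The edgewise estimate is summed with \<open>y = n + s\<close>, and the two shares at
  each point are bounded by \<open>potential_ge\<close>. The offset \<open>s\<close> covers both
  grids: 0 for the integers, -1/2 for the half-integers.\<close>

lemma weighted_energy_ge:
  fixes s :: real and j :: nat
  assumes fin: "finite {n. u n \<noteq> 0}"
  defines "v \<equiv> \<lambda>n. of_real ((of_int n + s) ^ Suc j) * u n"
  shows "(\<Sum>\<^sub>\<infinity>n. (cmod (bdiff v n))\<^sup>2)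
      + (real j + 1) * real j * (\<Sum>\<^sub>\<infinity>n. (cmod (u n))\<^sup>2 * (of_int n + s) ^ (2 * j))
    \<le> (\<Sum>\<^sub>\<infinity>n. (cmod (bdiff u n))\<^sup>2 * (of_int n + s - 1/2) ^ (2 * Suc j))"
    (is "?D + ?c * ?P \<le> ?E")
proof -
  have fin_v: "finite {n. v n \<noteq> 0}"
    by (rule finite_subset[OF _ fin]) (auto simp: v_def)
  have D: "(\<lambda>n. (cmod (bdiff v n))\<^sup>2) summable_on UNIV"
    by (rule summable_on_finite_support[OF finite_support_bdiff[OF fin_v]]) simp
  then have D': "(\<lambda>n. - (cmod (bdiff v n))\<^sup>2) summable_on UNIV"
    by (simp add: summable_on_uminus)
  have E: "(\<lambda>n. (cmod (bdiff u n))\<^sup>2 * (of_int n + s - 1/2) ^ (2 * Suc j)) summable_on UNIV"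
    by (rule summable_on_finite_support[OF finite_support_bdiff[OF fin]]) simp
  have "(\<Sum>\<^sub>\<infinity>n. (?c * (of_int n + s) ^ (2 * j)) * (cmod (u n))\<^sup>2)
    \<le> (\<Sum>\<^sub>\<infinity>n. (cmod (bdiff u n))\<^sup>2 * (of_int n + s - 1/2) ^ (2 * Suc j) - (cmod (bdiff v n))\<^sup>2)"
  proof (rule infsum_telescope_weights[OF fin, where
      A = "\<lambda>n. (of_int n + s - 1/2) ^ (2 * Suc j) - ((of_int n + s)\<^sup>2 + 1/4) ^ Suc j" and
      B = "\<lambda>n. (of_int n + s - 1/2) ^ (2 * Suc j) - ((of_int n + s - 1)\<^sup>2 + 1/4) ^ Suc j"])
    show "(\<lambda>n. (cmod (bdiff u n))\<^sup>2 * (of_int n + s - 1/2) ^ (2 * Suc j) - (cmod (bdiff v n))\<^sup>2)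
      summable_on UNIV"
      using summable_on_add[OF E D'] by simp
    fix n :: int
    have v1: "v (n - 1) = of_real ((of_int n + s - 1) ^ Suc j) * u (n - 1)"
      by (simp add: v_def algebra_simps)
    show "((of_int n + s - 1/2) ^ (2 * Suc j) - ((of_int n + s)\<^sup>2 + 1/4) ^ Suc j) * (cmod (u n))\<^sup>2
      + ((of_int n + s - 1/2) ^ (2 * Suc j) - ((of_int n + s - 1)\<^sup>2 + 1/4) ^ Suc j) * (cmod (u (n - 1)))\<^sup>2
      \<le> (cmod (bdiff u n))\<^sup>2 * (of_int n + s - 1/2) ^ (2 * Suc j) - (cmod (bdiff v n))\<^sup>2"
      using weighted_difference_ge[OF refl, of "of_int n + s" "Suc j" "u n" "u (n - 1)"]
      unfolding bdiff_def v1 unfolding v_def by linarith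
    have eqs: "real_of_int (n + 1) + s - 1/2 = of_int n + s + 1/2"
      "real_of_int (n + 1) + s - 1 = of_int n + s" by simp_all
    show "(?c * (of_int n + s) ^ (2 * j)) * (cmod (u n))\<^sup>2
      \<le> ((of_int n + s - 1/2) ^ (2 * Suc j) - ((of_int n + s)\<^sup>2 + 1/4) ^ Suc j
        + ((of_int (n + 1) + s - 1/2) ^ (2 * Suc j) - ((of_int (n + 1) + s - 1)\<^sup>2 + 1/4) ^ Suc j))
        * (cmod (u n))\<^sup>2"
      unfolding eqs using potential_ge[of j "of_int n + s"] by (intro mult_right_mono) auto
  qed
  also have "\<dots> = ?E - ?D" using infsum_add[OF E D'] by (simp add: infsum_uminus)
  also have "(\<Sum>\<^sub>\<infinity>n. (?c * (of_int n + s) ^ (2 * j)) * (cmod (u n))\<^sup>2) = ?c * ?P"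
    by (subst infsum_cmult_right'[symmetric]) (simp add: mult_ac)
  finally show ?thesis by simp
qed

text \<open>The side condition only concerns the term at \<open>n = 0\<close>, where \<open>0 ^ 0 = 1\<close>.\<close>

lemma hardy_weighted:
  assumes fin: "finite {n. u n \<noteq> 0}" and u0: "u 0 = 0 \<or> j > 0"
  shows "(real j + 1/2)\<^sup>2 * (\<Sum>\<^sub>\<infinity>n. (cmod (u n))\<^sup>2 * real_of_int n ^ (2 * j))
    \<le> (\<Sum>\<^sub>\<infinity>n. (cmod (bdiff u n))\<^sup>2 * (real_of_int n - 1/2) ^ (2 * Suc j))"
    (is "_ * ?P \<le> ?E")
proof -
  define v where "v n = of_real (of_int n ^ Suc j) * u n" for n
  have fin_v: "finite {n. v n \<noteq> 0}"
    by (rule finite_subset[OF _ fin]) (auto simp: v_def)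
  \<comment> \<open>The factor \<open>n ^ Suc j\<close> in \<open>v\<close> trades the weight
    \<open>n ^ (2 * j)\<close> for the classical Hardy weight. At \<open>n = 0\<close> the left side
    vanishes by the side condition, the right because \<open>v 0 = 0\<close>.\<close>
  have "1/4 * ((cmod (u n))\<^sup>2 * real_of_int n ^ (2 * j))
      = 1 / (4 * (real_of_int n)\<^sup>2) * (cmod (v n))\<^sup>2" for n
  proof (cases "n = 0")
    case True
    then show ?thesis using u0 by auto
  next
    case False
    have "cmod (v n) = \<bar>real_of_int n ^ Suc j\<bar> * cmod (u n)"
      by (simp add: v_def norm_mult norm_power abs_mult power_abs)
    then have "(cmod (v n))\<^sup>2 = (real_of_int n ^ Suc j)\<^sup>2 * (cmod (u n))\<^sup>2"
      by (simp only: power_mult_distrib power2_abs)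
    also have "(real_of_int n ^ Suc j)\<^sup>2 = (real_of_int n)\<^sup>2 * real_of_int n ^ (2 * j)"
      by (simp only: power_Suc power_mult_distrib) (simp only: power_mult[symmetric] mult.commute)
    finally have "(cmod (v n))\<^sup>2 = (real_of_int n)\<^sup>2 * (real_of_int n ^ (2 * j) * (cmod (u n))\<^sup>2)"
      by (simp only: mult.assoc)
    then show ?thesis using False by simp
  qed
  then have "1/4 * ?P = (\<Sum>\<^sub>\<infinity>n. 1 / (4 * (real_of_int n)\<^sup>2) * (cmod (v n))\<^sup>2)"
    by (simp flip: infsum_cmult_right')
  also have "\<dots> \<le> (\<Sum>\<^sub>\<infinity>n. (cmod (bdiff v n))\<^sup>2)"
    by (rule hardy_int[OF fin_v]) (simp add: v_def)
  \<comment> \<open>The two constants combine exactly: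
    \<open>1/4 + j * (j + 1) = (j + 1/2)^2\<close>.\<close>
  finally have "1/4 * ?P + (real j + 1) * real j * ?P \<le> ?E"
    using weighted_energy_ge[OF fin, of 0 j] by (simp add: v_def[abs_def])
  then show ?thesis by (simp add: power2_eq_square algebra_simps)
qed

section \<open>The Rellich inequality and its iteration\<close>

text \<open>With \<open>k = j + 2\<close>, passing from \<open>bdiff (bdiff u)\<close> to
  \<open>bdiff u\<close> costs \<open>k * (k - 1)\<close> and passing from \<open>bdiff u\<close> to
  \<open>u\<close> costs \<open>(k - 3/2)^2\<close>; the product is
  \<open>rellich_const k\<close>.\<close>

lemma rellich_weighted:
  assumes fin: "finite {n. u n \<noteq> 0}" and u0: "u 0 = 0 \<or> j > 0"
  shows "rellich_const (int j + 2) * (\<Sum>\<^sub>\<infinity>n. (cmod (u n))\<^sup>2 * real_of_int n ^ (2 * j))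
    \<le> (\<Sum>\<^sub>\<infinity>n. (cmod (lap u n))\<^sup>2 * real_of_int n ^ (2 * (j + 2)))"
    (is "_ * ?P \<le> ?E")
proof -
  let ?H = "\<Sum>\<^sub>\<infinity>n. (cmod (bdiff u n))\<^sup>2 * (real_of_int n - 1/2) ^ (2 * Suc j)"
  have "rellich_const (int j + 2) * ?P = (real j + 2) * (real j + 1) * ((real j + 1/2)\<^sup>2 * ?P)"
    by (simp add: rellich_const_def mult.assoc add.commute)
  also have "\<dots> \<le> (real j + 2) * (real j + 1) * ?H"
    by (rule mult_left_mono[OF hardy_weighted[OF fin u0]]) simp
  also have "\<dots> \<le> (\<Sum>\<^sub>\<infinity>n. (cmod (bdiff (bdiff u) n))\<^sup>2 * (real_of_int n + - 1/2 - 1/2) ^ (2 * Suc (Suc j)))"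
    (is "_ \<le> ?F")
  proof -
    \<comment> \<open>On the half-integers the energy of the multiplied function is simply dropped,
      leaving the potential term.\<close>
    have "0 \<le> (\<Sum>\<^sub>\<infinity>n. (cmod (bdiff (\<lambda>n. of_real ((of_int n + - 1/2) ^ Suc (Suc j)) * bdiff u n) n))\<^sup>2)"
      by (rule infsum_nonneg) simp
    then show ?thesis
      using weighted_energy_ge[OF finite_support_bdiff[OF fin], of "-1/2" "Suc j"]
      by (simp add: algebra_simps)
  qed
  \<comment> \<open>The two half-steps centre the weight at \<open>n - 1\<close>; the shift
    recentres it at \<open>n\<close>, matching \<open>lap u n\<close>.\<close>
  also have "?F = (\<Sum>\<^sub>\<infinity>n. (cmod (bdiff (bdiff u) (n + 1)))\<^sup>2
      * (real_of_int (n + 1) + - 1/2 - 1/2) ^ (2 * Suc (Suc j)))"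
    by (rule infsum_shift_int[symmetric])
  also have "\<dots> = ?E" by (simp add: lap_eq_bdiff_bdiff)
  finally show ?thesis .
qed

lemma rellich_const_nonneg: "k \<ge> 1 \<Longrightarrow> rellich_const k \<ge> 0"
  by (simp add: rellich_const_def)

lemma rellich_iterated:
  assumes fin: "finite {n. u n \<noteq> 0}" and u0: "u 0 = 0"
  shows "(\<Prod>i = 0..<m. rellich_const (int (l + 2 * m) - 2 * int i)) *
      (\<Sum>\<^sub>\<infinity>n. (cmod (u n))\<^sup>2 * real_of_int n ^ (2 * l))
    \<le> (\<Sum>\<^sub>\<infinity>n. (cmod ((lap ^^ m) u n))\<^sup>2 * real_of_int n ^ (2 * (l + 2 * m)))"
proof (induction m)
  case 0
  then show ?case by simp
next
  case (Suc m)
  define j where "j = l + 2 * m"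
  have prod: "(\<Prod>i = 0..<Suc m. rellich_const (int (l + 2 * Suc m) - 2 * int i))
      = rellich_const (int j + 2) * (\<Prod>i = 0..<m. rellich_const (int (l + 2 * m) - 2 * int i))"
    by (subst prod.atLeast0_lessThan_Suc_shift) (simp add: j_def algebra_simps)
  have "(\<Prod>i = 0..<Suc m. rellich_const (int (l + 2 * Suc m) - 2 * int i)) *
      (\<Sum>\<^sub>\<infinity>n. (cmod (u n))\<^sup>2 * real_of_int n ^ (2 * l))
    \<le> rellich_const (int j + 2) * (\<Sum>\<^sub>\<infinity>n. (cmod ((lap ^^ m) u n))\<^sup>2 * real_of_int n ^ (2 * j))"
    unfolding prod mult.assoc j_def by (intro mult_left_mono Suc.IH rellich_const_nonneg) simp
  also have "\<dots> \<le> (\<Sum>\<^sub>\<infinity>n. (cmod (lap ((lap ^^ m) u) n))\<^sup>2 * real_of_int n ^ (2 * (j + 2)))"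
    \<comment> \<open>For \<open>m = 0\<close> the function is \<open>u\<close>, which vanishes at
      0. Later iterates may be nonzero there, but then \<open>j = l + 2 * m\<close> is
      positive.\<close>
    by (rule rellich_weighted[OF finite_support_lap_funpow[OF fin]])
       (use u0 in \<open>cases m; simp add: j_def\<close>)
  finally show ?case by (simp add: j_def)
qed

theorem theorem2p4:
  fixes m :: nat and u :: "int \<Rightarrow> complex"
  assumes "m \<ge> 1"
    and "finite {n. u n \<noteq> 0}"
    and "u 0 = 0"
  shows "(\<forall>k::int. k \<ge> 2 * int m \<longrightarrow>
            (\<Sum>\<^sub>\<infinity>n::int. (cmod ((lap ^^ m) u n))\<^sup>2 * real_of_int n powi (2 * k))
            \<ge> (\<Prod>i = 0..<m. rellich_const (k - 2 * int i)) *
               (\<Sum>\<^sub>\<infinity>n::int. (cmod (u n))\<^sup>2 * real_of_int n powi (2 * k - 4 * int m)))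
       \<and> (\<forall>k::int. k \<ge> 2 * int m + 1 \<longrightarrow>
            (\<Sum>\<^sub>\<infinity>n::int. (cmod (bdiff ((lap ^^ m) u) n))\<^sup>2 * (real_of_int n - 1/2) powi (2 * k))
            \<ge> (2 * real_of_int k - 1)\<^sup>2 / 4 *
               (\<Prod>i = 0..<m. rellich_const (k - 1 - 2 * int i)) *
               (\<Sum>\<^sub>\<infinity>n::int. (cmod (u n))\<^sup>2 * real_of_int n powi (2 * k - 4 * int m - 2)))"
proof (intro conjI allI impI)
  fix k :: int
  assume "k \<ge> 2 * int m"
  then obtain l where "k = 2 * int m + int l" using zle_iff_zadd by blast
  then have k: "k = int (l + 2 * m)" by simp
  have exps: "2 * k - 4 * int m = int (2 * l)" "2 * k = int (2 * (l + 2 * m))"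
    by (simp_all add: k)
  show "(\<Prod>i = 0..<m. rellich_const (k - 2 * int i)) *
      (\<Sum>\<^sub>\<infinity>n. (cmod (u n))\<^sup>2 * real_of_int n powi (2 * k - 4 * int m))
    \<le> (\<Sum>\<^sub>\<infinity>n. (cmod ((lap ^^ m) u n))\<^sup>2 * real_of_int n powi (2 * k))"
    unfolding exps(1) unfolding exps(2) power_int_of_nat unfolding k by (rule rellich_iterated[OF assms(2,3)])
next
  fix k :: int
  assume "k \<ge> 2 * int m + 1"
  then obtain l where "k = 2 * int m + 1 + int l" using zle_iff_zadd by blast
  then have k: "k = int (Suc (l + 2 * m))" by simp
  have exps: "2 * k - 4 * int m - 2 = int (2 * l)" "2 * k = int (2 * Suc (l + 2 * m))"
    by (simp_all add: k)
  have k1: "k - 1 = int (l + 2 * m)" by (simp add: k)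
  have const: "(2 * real_of_int k - 1)\<^sup>2 / 4 = (real (l + 2 * m) + 1/2)\<^sup>2"
    by (simp add: k power2_eq_square algebra_simps)
  have "(2 * real_of_int k - 1)\<^sup>2 / 4 * ((\<Prod>i = 0..<m. rellich_const (k - 1 - 2 * int i)) *
      (\<Sum>\<^sub>\<infinity>n. (cmod (u n))\<^sup>2 * real_of_int n ^ (2 * l)))
    \<le> (real (l + 2 * m) + 1/2)\<^sup>2 *
      (\<Sum>\<^sub>\<infinity>n. (cmod ((lap ^^ m) u n))\<^sup>2 * real_of_int n ^ (2 * (l + 2 * m)))"
    unfolding const k1 by (rule mult_left_mono[OF rellich_iterated[OF assms(2,3)]]) simp
  \<comment> \<open>One Hardy step for the iterated Laplacian, with exponent
    \<open>k - 1 = l + 2 * m\<close>. It is positive because \<open>m\<close> is at least 1, so the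
    value of that iterate at 0 may be arbitrary.\<close>
  also have "\<dots> \<le> (\<Sum>\<^sub>\<infinity>n. (cmod (bdiff ((lap ^^ m) u) n))\<^sup>2
      * (real_of_int n - 1/2) ^ (2 * Suc (l + 2 * m)))"
    by (rule hardy_weighted[OF finite_support_lap_funpow[OF assms(2)]]) (use assms(1) in simp)
  finally show "(2 * real_of_int k - 1)\<^sup>2 / 4 * (\<Prod>i = 0..<m. rellich_const (k - 1 - 2 * int i)) *
      (\<Sum>\<^sub>\<infinity>n. (cmod (u n))\<^sup>2 * real_of_int n powi (2 * k - 4 * int m - 2))
    \<le> (\<Sum>\<^sub>\<infinity>n. (cmod (bdiff ((lap ^^ m) u) n))\<^sup>2 * (real_of_int n - 1/2) powi (2 * k))"
    unfolding exps(1) unfolding exps(2) power_int_of_nat mult.assoc .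
qed

end
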